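(* $\mathsf{RT}^1_3\le_\mathrm{sW}\mathsf{ADC}$.
   Context: Problems are multi-valued partial functions $\subseteq\omega^\omega\rightrightarrows\omega^\omega$ with standard codings. $\mathcal{F}\le_\mathrm{sW}\mathcal{G}$ if there are Turing functionals $\Phi,\Psi$ with $\Phi(f)\in\mathrm{dom}(\mathcal{G})$ for all $f\in\mathrm{dom}(\mathcal{F})$ and $\Psi(g)\in\mathcal{F}(f)$ for all $f\in\mathrm{dom}(\mathcal F)$, $g\in\mathcal{G}(\Phi(f))$. $\mathsf{RT}^1_3$: input $c\colon\omega\to\{0,1,2\}$; output an infinite $H\subseteq\omega$ on which $c$ is constant. $\mathsf{ADC}$: input an infinite linear order $(L,<_L)$ with $L\subseteq\omega$; output an infinite $S\subseteq L$ that is an ascending chain ($\{x\in S:x<_Ly\}$ finite for every $y\in S$) or a descending chain ($\{x\in S:y<_Lx\}$ finite for every $y\in S$). *)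

theory Defs
  imports "HOL-Library.Nat_Bijection" "HOL-Library.Infinite_Set"
begin

text \<open>
  Turing functionals are given by the usual partial recursive schemes with the oracle as an
  additional basic function. A program is a finite object independent of the oracle, so
  computations are uniform in the oracle. Arities are not tracked: successor, query, projection
  and primitive recursion diverge on argument lists of unsuitable length.
\<close>

datatype prog =
    Zero
  | Succ
  | Proj nat
  | Query
  | Comp prog "prog list"
  | PrimRec prog prog
  | Mu prog

inductive computes :: "(nat \<Rightarrow> nat) \<Rightarrow> prog \<Rightarrow> nat list \<Rightarrow> nat \<Rightarrow> bool"
  for f :: "nat \<Rightarrow> nat" where
  zero: "computes f Zero xs 0"
| succ: "computes f Succ [x] (Suc x)"
| proj: "i < length xs \<Longrightarrow> computes f (Proj i) xs (xs ! i)"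
| query: "computes f Query [x] (f x)"
| comp: "list_all2 (\<lambda>g y. computes f g xs y) gs ys \<Longrightarrow> computes f h ys z
    \<Longrightarrow> computes f (Comp h gs) xs z"
| rec_0: "computes f g xs y \<Longrightarrow> computes f (PrimRec g h) (0 # xs) y"
| rec_Suc: "computes f (PrimRec g h) (n # xs) r \<Longrightarrow> computes f h (n # r # xs) y
    \<Longrightarrow> computes f (PrimRec g h) (Suc n # xs) y"
| mu: "computes f g (n # xs) 0 \<Longrightarrow> (\<forall>m<n. \<exists>y. computes f g (m # xs) (Suc y))
    \<Longrightarrow> computes f (Mu g) xs n"

inductive_cases computes_ZeroE: "computes f Zero xs y"
inductive_cases computes_SuccE: "computes f Succ xs y"
inductive_cases computes_ProjE: "computes f (Proj i) xs y"
inductive_cases computes_QueryE: "computes f Query xs y"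
inductive_cases computes_CompE: "computes f (Comp h gs) xs y"
inductive_cases computes_PrimRec0E: "computes f (PrimRec g h) (0 # xs) y"
inductive_cases computes_PrimRecSucE: "computes f (PrimRec g h) (Suc n # xs) y"
inductive_cases computes_MuE: "computes f (Mu g) xs y"

lemma computes_deterministic:
  "computes f p xs y \<Longrightarrow> computes f p xs z \<Longrightarrow> y = z"
proof (induction arbitrary: z rule: computes.induct)
  case (comp xs gs ys h z')
  obtain ys' where ys': "list_all2 (\<lambda>g y. computes f g xs y) gs ys'" "computes f h ys' z"
    using comp.prems by (auto elim: computes_CompE)
  have len: "length ys = length gs" "length ys' = length gs"
    using list_all2_lengthD[OF comp.IH(1)] list_all2_lengthD[OF ys'(1)] by simp_all
  have "ys = ys'"
  proof (rule nth_equalityI)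
    fix i assume "i < length ys"
    then have i: "i < length gs" using len by simp
    show "ys ! i = ys' ! i"
      using list_all2_nthD[OF comp.IH(1) i] list_all2_nthD[OF ys'(1) i] by blast
  qed (simp add: len)
  then show ?case using comp.IH(2) ys'(2) by simp
next
  case (rec_0 g xs y h)
  from rec_0.prems have "computes f g xs z" by (rule computes_PrimRec0E)
  then show ?case by (rule rec_0.IH)
next
  case (rec_Suc g h n xs r y)
  from rec_Suc.prems obtain r' where "computes f (PrimRec g h) (n # xs) r'"
    and "computes f h (n # r' # xs) z" by (rule computes_PrimRecSucE)
  then show ?case using rec_Suc.IH by blast
next
  case (mu g n xs)
  have z: "computes f g (z # xs) 0" "\<forall>m<z. \<exists>y. computes f g (m # xs) (Suc y)"
    using mu.prems by (blast elim: computes_MuE)+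
  have "\<not> z < n" using mu.IH(2) z(1) by blast
  moreover have "\<not> n < z" using mu.IH(1) z(2) by blast
  ultimately show ?case by simp
next
  case (zero xs)
  then show ?case by (rule computes_ZeroE) simp
next
  case (succ x)
  then show ?case by (rule computes_SuccE) simp
next
  case (proj i xs)
  from proj(2) show ?case by (rule computes_ProjE) simp
next
  case (query x)
  then show ?case by (rule computes_QueryE) simp
qed

text \<open>
  The partial functional on Baire space of a program: defined at \<open>f\<close> iff the computation with
  oracle \<open>f\<close> halts on every input.
\<close>

definition prog_functional :: "prog \<Rightarrow> (nat \<Rightarrow> nat) \<Rightarrow> (nat \<Rightarrow> nat) option" where
  "prog_functional p f =
     (if \<forall>n. \<exists>y. computes f p [n] y then Some (\<lambda>n. THE y. computes f p [n] y) else None)"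

lemma prog_functional_eq_Some_iff:
  "prog_functional p f = Some g \<longleftrightarrow> (\<forall>n. computes f p [n] (g n))"
proof -
  have the: "(THE y. computes f p [n] y) = y" if "computes f p [n] y" for n y
    using that computes_deterministic by blast
  then show ?thesis
  proof (cases "\<forall>n. \<exists>y. computes f p [n] y")
    case True
    then obtain g' where g': "\<And>n. computes f p [n] (g' n)" by metis
    have "prog_functional p f = Some g'"
      using True the[OF g'] by (simp add: prog_functional_def)
    then show ?thesis
      using g' computes_deterministic[OF g'] by (auto simp: fun_eq_iff)
  next
    case False
    then show ?thesis by (auto simp: prog_functional_def)
  qed
qed

definition turing_functional :: "((nat \<Rightarrow> nat) \<Rightarrow> (nat \<Rightarrow> nat) option) \<Rightarrow> bool" where
  "turing_functional \<Phi> \<longleftrightarrow> (\<exists>p. \<Phi> = prog_functional p)"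

text \<open>
  A problem, i.e. a partial multi-valued function on Baire space, is given by its graph; its
  domain is the domain of this relation.
\<close>

type_synonym problem = "((nat \<Rightarrow> nat) \<times> (nat \<Rightarrow> nat)) set"

definition sW_reducible :: "problem \<Rightarrow> problem \<Rightarrow> bool"  (infix "\<le>\<^sub>s\<^sub>W" 50) where
  "F \<le>\<^sub>s\<^sub>W G \<longleftrightarrow> (\<exists>\<Phi> \<Psi>. turing_functional \<Phi> \<and> turing_functional \<Psi> \<and>
     (\<forall>f \<in> Domain F. \<exists>h \<in> Domain G. \<Phi> f = Some h \<and>
        (\<forall>g. (h, g) \<in> G \<longrightarrow> (\<exists>k. \<Psi> g = Some k \<and> (f, k) \<in> F))))"

definition char_fun :: "nat set \<Rightarrow> nat \<Rightarrow> nat" where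
  "char_fun A n = of_bool (n \<in> A)"

lemma char_fun_inject: "char_fun A = char_fun B \<longleftrightarrow> A = B"
  by (auto simp: char_fun_def fun_eq_iff)

definition RT1 :: "nat \<Rightarrow> problem" where
  "RT1 k = {(c, char_fun H) | c H.
     (\<forall>n. c n < k) \<and> infinite H \<and> (\<exists>i. \<forall>n \<in> H. c n = i)}"

lemma Domain_RT1: "Domain (RT1 k) = {c. \<forall>n. c n < k}"
proof -
  have "\<exists>H. infinite H \<and> (\<exists>i. \<forall>n \<in> H. c n = i)" if "\<forall>n. c n < k" for c :: "nat \<Rightarrow> nat"
  proof -
    have "finite (range c)"
      using that by (auto intro: finite_subset[of _ "{..<k}"])
    then obtain i where "infinite {n. c n = i}"
      using pigeonhole_infinite[of "UNIV :: nat set" c] by auto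
    then show ?thesis by blast
  qed
  then show ?thesis by (auto simp: RT1_def Domain_iff)
qed

definition is_lin_order :: "nat set \<Rightarrow> nat rel \<Rightarrow> bool" where
  "is_lin_order L r \<longleftrightarrow> r \<subseteq> L \<times> L \<and> strict_linear_order_on L r"

text \<open>
  A linear order is coded as the join of the characteristic functions of its field and of its
  strict order relation (under the Cantor pairing).
\<close>

definition order_code :: "nat set \<Rightarrow> nat rel \<Rightarrow> nat \<Rightarrow> nat" where
  "order_code L r n =
     (if even n then char_fun L (n div 2) else char_fun (prod_encode ` r) (n div 2))"

lemma order_code_inject: "order_code L r = order_code L' r' \<longleftrightarrow> L = L' \<and> r = r'"
proof
  assume eq: "order_code L r = order_code L' r'"
  have "char_fun L n = char_fun L' n" for n
    using fun_cong[OF eq, of "2 * n"] by (simp add: order_code_def)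
  moreover have "char_fun (prod_encode ` r) n = char_fun (prod_encode ` r') n" for n
    using fun_cong[OF eq, of "Suc (2 * n)"] by (simp add: order_code_def)
  ultimately have "L = L'" "prod_encode ` r = prod_encode ` r'"
    by (metis char_fun_inject ext)+
  then show "L = L' \<and> r = r'" by (metis inj_image_eq_iff inj_prod_encode)
qed simp

definition ascending_chain :: "nat rel \<Rightarrow> nat set \<Rightarrow> bool" where
  "ascending_chain r S \<longleftrightarrow> (\<forall>y \<in> S. finite {x \<in> S. (x, y) \<in> r})"

definition descending_chain :: "nat rel \<Rightarrow> nat set \<Rightarrow> bool" where
  "descending_chain r S \<longleftrightarrow> (\<forall>y \<in> S. finite {x \<in> S. (y, x) \<in> r})"

definition ADC :: problem where
  "ADC = {(order_code L r, char_fun S) | L r S.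
     infinite L \<and> is_lin_order L r \<and>
     S \<subseteq> L \<and> infinite S \<and> (ascending_chain r S \<or> descending_chain r S)}"

lemma ex_chain:
  assumes inf: "infinite L" and lin: "is_lin_order L r"
  shows "\<exists>S \<subseteq> L. infinite S \<and> (ascending_chain r S \<or> descending_chain r S)"
proof -
  have tr: "trans r" and irr: "irrefl r"
    using lin by (auto simp: is_lin_order_def strict_linear_order_on_def)
  define A where "A = {y \<in> L. finite {x \<in> L. (x, y) \<in> r}}"
  show ?thesis
  proof (cases "finite A")
    case False
    have "finite {x \<in> A. (x, y) \<in> r}" if "y \<in> A" for y
      using that by (auto simp: A_def intro: finite_subset[of _ "{x \<in> L. (x, y) \<in> r}"])
    then show ?thesis
      using False by (intro exI[of _ A]) (auto simp: A_def ascending_chain_def)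
  next
    case True
    define T where "T = L - A"
    have "infinite T" using inf True by (simp add: T_def)
    then obtain t0 where t0: "t0 \<in> T" by (metis finite.emptyI ex_in_conv)
    have below: "\<exists>x. x \<in> T \<and> (x, y) \<in> r" if "y \<in> T" for y
    proof -
      have "infinite ({x \<in> L. (x, y) \<in> r} - A)" using that True by (auto simp: T_def A_def)
      then obtain x where "x \<in> {x \<in> L. (x, y) \<in> r} - A" by (metis finite.emptyI ex_in_conv)
      then show ?thesis by (auto simp: T_def)
    qed
    then obtain d where d: "\<And>y. y \<in> T \<Longrightarrow> d y \<in> T \<and> (d y, y) \<in> r" by metis
    define s where "s n = (d ^^ n) t0" for n
    have sT: "s n \<in> T" for n by (induction n) (use t0 d in \<open>auto simp: s_def\<close>)
    have sS: "(s (Suc n), s n) \<in> r" for n using d[OF sT[of n]] by (simp add: s_def)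
    have dec: "(s n, s m) \<in> r" if "m < n" for m n
      using that by (induction rule: less_Suc_induct) (use sS tr in \<open>auto dest: transD\<close>)
    have "inj s"
      by (rule injI) (metis dec irr irrefl_def linorder_neqE_nat)
    then have "infinite (range s)" by (simp add: range_inj_infinite)
    moreover have "finite {x \<in> range s. (s n, x) \<in> r}" for n
    proof -
      have "{x \<in> range s. (s n, x) \<in> r} \<subseteq> s ` {..<n}"
      proof clarify
        fix m assume "(s n, s m) \<in> r"
        then have "m < n" using dec irr tr by (metis irrefl_def linorder_neqE_nat transD)
        then show "s m \<in> s ` {..<n}" by simp
      qed
      then show ?thesis by (rule finite_subset) simp
    qed
    ultimately show ?thesis
      using sT by (intro exI[of _ "range s"]) (auto simp: T_def descending_chain_def)
  qed
qed

lemma Domain_ADC: "Domain ADC = {order_code L r | L r. infinite L \<and> is_lin_order L r}"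
proof (intro set_eqI iffI)
  fix h assume "h \<in> {order_code L r | L r. infinite L \<and> is_lin_order L r}"
  then obtain L r where h: "h = order_code L r" "infinite L" "is_lin_order L r" by auto
  obtain S where "S \<subseteq> L" "infinite S" "ascending_chain r S \<or> descending_chain r S"
    using ex_chain[OF h(2,3)] by auto
  with h have "(h, char_fun S) \<in> ADC" unfolding ADC_def by auto
  then show "h \<in> Domain ADC" by (rule DomainI)
qed (auto simp: ADC_def)

end

theory Submission
  imports Defs
begin

text \<open>
  From a colouring \<open>c\<close> we build an order on \<open>\<omega>\<close> with the property that an element whose colour
  occurs only finitely often lies in no infinite chain. Each \<open>n\<close> is put on the left if \<open>c n = 0\<close>,
  on the right if \<open>c n = 1\<close>, and, if \<open>c n = 2\<close>, on the left or right according to whether 1 or 0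
  is the more recent of these two colours. On the left side, later maximal monochromatic runs
  precede earlier ones and each run is ascending; the right side is the mirror image. If a colour
  occurs only finitely often, both sides are eventually monochromatic in the other two colours, so
  an element of that colour has almost all of the left side below it, in order type \<open>\<omega>\<close>, and almost
  all of the right side above it, in order type \<open>\<omega>\<^sup>*\<close>.

  The element \<open>n\<close> is represented by a code of \<open>c\<close> restricted to \<open>{0..n}\<close>, so that an infinite chain
  computes \<open>c\<close>. The backward functional takes the colour of the numerically least element of the
  chain and returns all numbers of that colour.
\<close>

section \<open>Closure properties of computable functionals\<close>

text \<open>The restriction to a set \<open>D\<close> of oracles is for unbounded search: the
  backward functional need only halt on oracles that code infinite sets of points. One program
  serves all of \<open>D\<close>, as uniformity demands.\<close>

definition computable_on ::
  "(nat \<Rightarrow> nat) set \<Rightarrow> nat \<Rightarrow> ((nat \<Rightarrow> nat) \<Rightarrow> nat list \<Rightarrow> nat) \<Rightarrow> bool" where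
  "computable_on D k F \<longleftrightarrow>
     (\<exists>p. \<forall>f \<in> D. \<forall>xs. length xs = k \<longrightarrow> computes f p xs (F f xs))"

abbreviation decidable_on ::
  "(nat \<Rightarrow> nat) set \<Rightarrow> nat \<Rightarrow> ((nat \<Rightarrow> nat) \<Rightarrow> nat list \<Rightarrow> bool) \<Rightarrow> bool" where
  "decidable_on D k P \<equiv> computable_on D k (\<lambda>f xs. of_bool (P f xs))"

lemma computable_onI:
  assumes "\<And>f xs. f \<in> D \<Longrightarrow> length xs = k \<Longrightarrow> computes f p xs (F f xs)"
  shows "computable_on D k F"
  using assms by (auto simp: computable_on_def)

text \<open>Composition with projections. It lets a function ignore the extra arguments that
  recursion puts in front of the list.\<close>

lemma computable_on_reindex:
  assumes F: "computable_on D (length idx) F" and "\<And>i. i \<in> set idx \<Longrightarrow> i < k"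
    and G: "\<And>f ys. length ys = k \<Longrightarrow> G f ys = F f (map ((!) ys) idx)"
  shows "computable_on D k G"
proof -
  obtain p where p: "\<And>f xs. f \<in> D \<Longrightarrow> length xs = length idx \<Longrightarrow> computes f p xs (F f xs)"
    using F by (auto simp: computable_on_def)
  show ?thesis
  proof (rule computable_onI[where p = "Comp p (map Proj idx)"])
    fix f and ys :: "nat list"
    assume f: "f \<in> D" and len: "length ys = k"
    then have "list_all2 (\<lambda>g y. computes f g ys y) (map Proj idx) (map ((!) ys) idx)"
      using assms(2) by (auto simp: list_all2_conv_all_nth computes.proj)
    then show "computes f (Comp p (map Proj idx)) ys (G f ys)"
      using p[OF f, of "map ((!) ys) idx"] G[OF len] by (auto intro: computes.comp)
  qed
qed

text \<open>Arguments are addressed as \<open>hd (tl (\<dots> xs))\<close>, so that the premises of the rules that bind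
  a variable again have the shape of their conclusions after instantiation.\<close>

lemma tl_funpow: "(tl ^^ i) xs = drop i xs"
  by (induction i) (simp_all add: tl_drop drop_Suc)

lemma computable_on_hd_tl:
  assumes "i < k"
  shows "computable_on D k (\<lambda>f xs. hd ((tl ^^ i) xs))"
proof (rule computable_onI[where p = "Proj i"])
  fix f and xs :: "nat list"
  assume "length xs = k"
  with assms have "i < length xs" by simp
  moreover from this have "hd ((tl ^^ i) xs) = xs ! i" by (simp add: tl_funpow hd_drop_conv_nth)
  ultimately show "computes f (Proj i) xs (hd ((tl ^^ i) xs))" by (simp add: computes.proj)
qed

text \<open>Spelled out with literal \<open>tl\<close> chains and \<open>Suc\<close> arities, so
  that the rules unify with variables under nested binders.\<close>

lemma computable_on_hd:
  "computable_on D (Suc k) (\<lambda>f xs. hd xs)"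
  "computable_on D (Suc (Suc k)) (\<lambda>f xs. hd (tl xs))"
  "computable_on D (Suc (Suc (Suc k))) (\<lambda>f xs. hd (tl (tl xs)))"
  "computable_on D (Suc (Suc (Suc (Suc k)))) (\<lambda>f xs. hd (tl (tl (tl xs))))"
  "computable_on D (Suc (Suc (Suc (Suc (Suc k))))) (\<lambda>f xs. hd (tl (tl (tl (tl xs)))))"
  "computable_on D (Suc (Suc (Suc (Suc (Suc (Suc k)))))) (\<lambda>f xs. hd (tl (tl (tl (tl (tl xs))))))"
  "computable_on D (Suc (Suc (Suc (Suc (Suc (Suc (Suc k))))))) (\<lambda>f xs. hd (tl (tl (tl (tl (tl (tl xs)))))))"
  "computable_on D (Suc (Suc (Suc (Suc (Suc (Suc (Suc (Suc k)))))))) (\<lambda>f xs. hd (tl (tl (tl (tl (tl (tl (tl xs))))))))"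
proof -
  have *: "computable_on D (i + Suc k) (\<lambda>f xs. hd ((tl ^^ i) xs))" for i
    by (rule computable_on_hd_tl) simp
  show "computable_on D (Suc k) (\<lambda>f xs. hd xs)"
    using *[of 0] by (simp add: numeral_eq_Suc)
  show "computable_on D (Suc (Suc k)) (\<lambda>f xs. hd (tl xs))"
    using *[of 1] by (simp add: numeral_eq_Suc)
  show "computable_on D (Suc (Suc (Suc k))) (\<lambda>f xs. hd (tl (tl xs)))"
    using *[of 2] by (simp add: numeral_eq_Suc)
  show "computable_on D (Suc (Suc (Suc (Suc k)))) (\<lambda>f xs. hd (tl (tl (tl xs))))"
    using *[of 3] by (simp add: numeral_eq_Suc)
  show "computable_on D (Suc (Suc (Suc (Suc (Suc k))))) (\<lambda>f xs. hd (tl (tl (tl (tl xs)))))"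
    using *[of 4] by (simp add: numeral_eq_Suc)
  show "computable_on D (Suc (Suc (Suc (Suc (Suc (Suc k)))))) (\<lambda>f xs. hd (tl (tl (tl (tl (tl xs))))))"
    using *[of 5] by (simp add: numeral_eq_Suc)
  show "computable_on D (Suc (Suc (Suc (Suc (Suc (Suc (Suc k))))))) (\<lambda>f xs. hd (tl (tl (tl (tl (tl (tl xs)))))))"
    using *[of 6] by (simp add: numeral_eq_Suc)
  show "computable_on D (Suc (Suc (Suc (Suc (Suc (Suc (Suc (Suc k)))))))) (\<lambda>f xs. hd (tl (tl (tl (tl (tl (tl (tl xs))))))))"
    using *[of 7] by (simp add: numeral_eq_Suc)
qed

lemma computable_on_Suc:
  assumes "computable_on D k F"
  shows "computable_on D k (\<lambda>f xs. Suc (F f xs))"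
proof -
  obtain p where p: "\<And>f xs. f \<in> D \<Longrightarrow> length xs = k \<Longrightarrow> computes f p xs (F f xs)"
    using assms by (auto simp: computable_on_def)
  show ?thesis
    by (rule computable_onI[where p = "Comp Succ [p]"])
      (rule computes.comp[OF _ computes.succ], simp add: p)
qed

lemma computable_on_query:
  assumes "computable_on D k F"
  shows "computable_on D k (\<lambda>f xs. f (F f xs))"
proof -
  obtain p where p: "\<And>f xs. f \<in> D \<Longrightarrow> length xs = k \<Longrightarrow> computes f p xs (F f xs)"
    using assms by (auto simp: computable_on_def)
  show ?thesis
    by (rule computable_onI[where p = "Comp Query [p]"])
      (rule computes.comp[OF _ computes.query], simp add: p)
qed

lemma computable_on_const: "computable_on D k (\<lambda>f xs. n)"
proof (induction n)
  case 0
  show ?case by (rule computable_onI[where p = Zero]) (rule computes.zero)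
next
  case (Suc n)
  then show ?case by (rule computable_on_Suc)
qed

lemma computable_on_rec:
  assumes "computable_on D k N" and "computable_on D k G"
    and "computable_on D (Suc (Suc k)) (\<lambda>f ys. H f (hd ys) (hd (tl ys)) (tl (tl ys)))"
  shows "computable_on D k (\<lambda>f xs. rec_nat (G f xs) (\<lambda>n r. H f n r xs) (N f xs))"
proof -
  obtain pn where pn: "\<And>f xs. f \<in> D \<Longrightarrow> length xs = k \<Longrightarrow> computes f pn xs (N f xs)"
    using assms(1) by (auto simp: computable_on_def)
  obtain pg where pg: "\<And>f xs. f \<in> D \<Longrightarrow> length xs = k \<Longrightarrow> computes f pg xs (G f xs)"
    using assms(2) by (auto simp: computable_on_def)
  obtain ph where ph: "\<And>f ys. f \<in> D \<Longrightarrow> length ys = Suc (Suc k) \<Longrightarrow>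
      computes f ph ys (H f (hd ys) (hd (tl ys)) (tl (tl ys)))"
    using assms(3) unfolding computable_on_def by blast
  show ?thesis
  \<comment> \<open>\<open>PrimRec\<close> recurses on the head of its list, so the bound computed
    by \<open>pn\<close> is put there and the projections copy \<open>xs\<close> behind it.\<close>
  proof (rule computable_onI[where p = "Comp (PrimRec pg ph) (pn # map Proj [0..<k])"])
    fix f and xs :: "nat list"
    assume f: "f \<in> D" and len: "length xs = k"
    have rec: "computes f (PrimRec pg ph) (n # xs) (rec_nat (G f xs) (\<lambda>n r. H f n r xs) n)" for n
    proof (induction n)
      case 0
      show ?case using computes.rec_0[OF pg[OF f len]] by simp
    next
      case (Suc n)
      show ?case
        using computes.rec_Suc[OF Suc ph[OF f]] len by simp
    qed
    have "list_all2 (\<lambda>g y. computes f g xs y) (map Proj [0..<k]) xs"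
      by (rule list_all2_all_nthI) (auto simp: len intro: computes.proj)
    then have "list_all2 (\<lambda>g y. computes f g xs y) (pn # map Proj [0..<k]) (N f xs # xs)"
      using pn[OF f len] by simp
    then show "computes f (Comp (PrimRec pg ph) (pn # map Proj [0..<k])) xs
        (rec_nat (G f xs) (\<lambda>n r. H f n r xs) (N f xs))"
      using rec by (rule computes.comp)
  qed
qed

lemma computable_on_add:
  assumes "computable_on D k F" and "computable_on D k G"
  shows "computable_on D k (\<lambda>f xs. F f xs + G f xs)"
proof -
  have "rec_nat a (\<lambda>n r. Suc r) b = a + b" for a b by (induction b) auto
  then show ?thesis
    using computable_on_rec[OF assms(2,1), of "\<lambda>f n r xs. Suc r"]
    by (simp add: computable_on_Suc computable_on_hd)
qed

lemma computable_on_diff: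
  assumes "computable_on D k F" and "computable_on D k G"
  shows "computable_on D k (\<lambda>f xs. F f xs - G f xs)"
proof -
  \<comment> \<open>The predecessor is a recursion that returns its counter; truncated subtraction
    then iterates it.\<close>
  have "rec_nat 0 (\<lambda>n r. n) a = a - 1" for a :: nat by (cases a) auto
  moreover have "computable_on D (Suc (Suc k)) (\<lambda>f ys. rec_nat 0 (\<lambda>n r. n) (hd (tl ys)))"
    by (rule computable_on_rec[where H = "\<lambda>f n r xs. n"])
      (rule computable_on_hd computable_on_const)+
  ultimately have "computable_on D (Suc (Suc k)) (\<lambda>f ys. hd (tl ys) - 1)" by simp
  moreover have "rec_nat a (\<lambda>n r. r - 1) b = a - b" for a b :: nat by (induction b) auto
  ultimately show ?thesis
    using computable_on_rec[OF assms(2,1), of "\<lambda>f n r xs. r - 1"] by simp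
qed

lemma computable_on_sum:
  assumes "computable_on D k B"
    and "computable_on D (Suc k) (\<lambda>f ys. F f (hd ys) (tl ys))"
  shows "computable_on D k (\<lambda>f xs. \<Sum>n<B f xs. F f n xs)"
proof -
  have "ys ! 0 = hd ys" "map ((!) ys) [2..<Suc (Suc k)] = tl (tl ys)"
    if "length ys = Suc (Suc k)" for ys :: "nat list"
  proof -
    show "ys ! 0 = hd ys" using that by (auto simp: length_Suc_conv)
    show "map ((!) ys) [2..<Suc (Suc k)] = tl (tl ys)"
      using that by (intro nth_equalityI) (auto simp: nth_tl simp del: upt_Suc)
  qed
  \<comment> \<open>The recursion step sees counter, partial sum and parameters; the summand must
    skip the partial sum at position 1.\<close>
  then have "computable_on D (Suc (Suc k)) (\<lambda>f ys. F f (hd ys) (tl (tl ys)))"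
    using assms(2)
    by - (rule computable_on_reindex[where idx = "0 # [2..<Suc (Suc k)]"
          and F = "\<lambda>f ys. F f (hd ys) (tl ys)"], auto simp del: upt_Suc)
  then have "computable_on D (Suc (Suc k)) (\<lambda>f ys. hd (tl ys) + F f (hd ys) (tl (tl ys)))"
    by (intro computable_on_add computable_on_hd)
  from computable_on_rec[OF assms(1) computable_on_const[of D k 0],
      of "\<lambda>f n r xs. r + F f n xs", OF this]
  have "computable_on D k (\<lambda>f xs. rec_nat 0 (\<lambda>n r. r + F f n xs) (B f xs))" .
  moreover have "rec_nat 0 (\<lambda>n r. r + F f n xs) b = (\<Sum>n<b. F f n xs)" for f xs b
    by (induction b) auto
  ultimately show ?thesis by simp
qed

text \<open>A product is a sum with constant summand, one factor being the number of terms.\<close>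

lemma computable_on_mult:
  assumes "computable_on D k F" and "computable_on D k G"
  shows "computable_on D k (\<lambda>f xs. F f xs * G f xs)"
proof -
  have "map ((!) ys) [1..<Suc k] = tl ys" if "length ys = Suc k" for ys :: "nat list"
    using that by (intro nth_equalityI) (auto simp: nth_tl simp del: upt_Suc)
  then have "computable_on D (Suc k) (\<lambda>f ys. F f (tl ys))"
    using assms(1)
    by - (rule computable_on_reindex[where idx = "[1..<Suc k]" and F = F], auto simp del: upt_Suc)
  from computable_on_sum[OF assms(2), of "\<lambda>f n xs. F f xs", OF this]
  show ?thesis by (simp add: mult.commute)
qed

lemma computable_on_power:
  assumes "computable_on D k F"
  shows "computable_on D k (\<lambda>f xs. b ^ F f xs)"
proof -
  have "rec_nat 1 (\<lambda>n r. b * r) a = b ^ a" for a by (induction a) auto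
  then show ?thesis
    using computable_on_rec[OF assms computable_on_const[of D k 1], of "\<lambda>f n r xs. b * r"]
    by (simp add: computable_on_mult computable_on_const computable_on_hd)
qed

section \<open>Decidable predicates, bounded quantifiers and search\<close>

lemma decidable_on_not:
  assumes "decidable_on D k P"
  shows "decidable_on D k (\<lambda>f xs. \<not> P f xs)"
proof -
  have "of_bool (\<not> b) = 1 - (of_bool b :: nat)" for b by simp
  then show ?thesis
    by (simp only:) (intro computable_on_diff computable_on_const assms)
qed

lemma decidable_on_conj:
  assumes "decidable_on D k P" and "decidable_on D k Q"
  shows "decidable_on D k (\<lambda>f xs. P f xs \<and> Q f xs)"
  unfolding of_bool_conj by (intro computable_on_mult assms)

lemma decidable_on_disj:
  assumes "decidable_on D k P" and "decidable_on D k Q"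
  shows "decidable_on D k (\<lambda>f xs. P f xs \<or> Q f xs)"
  using decidable_on_not[OF decidable_on_conj[OF decidable_on_not decidable_on_not, OF assms]]
  by simp

lemma decidable_on_imp:
  assumes "decidable_on D k P" and "decidable_on D k Q"
  shows "decidable_on D k (\<lambda>f xs. P f xs \<longrightarrow> Q f xs)"
  unfolding imp_conv_disj by (intro decidable_on_disj decidable_on_not assms)

lemma decidable_on_iff:
  assumes "decidable_on D k P" and "decidable_on D k Q"
  shows "decidable_on D k (\<lambda>f xs. P f xs \<longleftrightarrow> Q f xs)"
  unfolding iff_conv_conj_imp by (intro decidable_on_conj decidable_on_imp assms)

lemma decidable_on_le:
  assumes "computable_on D k F" and "computable_on D k G"
  shows "decidable_on D k (\<lambda>f xs. F f xs \<le> G f xs)"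
proof -
  \<comment> \<open>Subtraction is truncated, so \<open>a - b\<close> vanishes exactly when
    \<open>a\<close> is at most \<open>b\<close>.\<close>
  have "of_bool (a \<le> b) = 1 - (a - b)" for a b :: nat by auto
  then show ?thesis
    by (simp only:) (intro computable_on_diff computable_on_const assms)
qed

lemma decidable_on_less:
  assumes "computable_on D k F" and "computable_on D k G"
  shows "decidable_on D k (\<lambda>f xs. F f xs < G f xs)"
  using decidable_on_not[OF decidable_on_le[OF assms(2,1)]] by (simp add: not_le)

lemma decidable_on_eq:
  fixes F G :: "(nat \<Rightarrow> nat) \<Rightarrow> nat list \<Rightarrow> nat"
  assumes "computable_on D k F" and "computable_on D k G"
  shows "decidable_on D k (\<lambda>f xs. F f xs = G f xs)"
  unfolding order_eq_iff by (intro decidable_on_conj decidable_on_le assms)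

text \<open>A bounded existential quantifier holds iff the sum of its truth values is
  positive.\<close>

lemma decidable_on_ex_less:
  assumes "computable_on D k B"
    and "decidable_on D (Suc k) (\<lambda>f ys. P f (hd ys) (tl ys))"
  shows "decidable_on D k (\<lambda>f xs. \<exists>n<B f xs. P f n xs)"
proof -
  have "decidable_on D k (\<lambda>f xs. 0 < (\<Sum>n<B f xs. of_bool (P f n xs) :: nat))"
    by (intro decidable_on_less computable_on_const computable_on_sum assms)
  moreover have "0 < (\<Sum>n<b. of_bool (Q n) :: nat) \<longleftrightarrow> (\<exists>n<b. Q n)" for b and Q :: "nat \<Rightarrow> bool"
    by (auto simp: neq0_conv[symmetric] simp del: neq0_conv)
  ultimately show ?thesis by simp
qed

lemma decidable_on_all_less:
  assumes "computable_on D k B"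
    and "decidable_on D (Suc k) (\<lambda>f ys. P f (hd ys) (tl ys))"
  shows "decidable_on D k (\<lambda>f xs. \<forall>n<B f xs. P f n xs)"
  using decidable_on_not[OF decidable_on_ex_less[OF assms(1) decidable_on_not, OF assms(2)]]
  by simp

lemma computable_on_Least:
  assumes "\<And>f xs. f \<in> D \<Longrightarrow> length xs = k \<Longrightarrow> \<exists>n. P f n xs"
    and "decidable_on D (Suc k) (\<lambda>f ys. P f (hd ys) (tl ys))"
  shows "computable_on D k (\<lambda>f xs. LEAST n. P f n xs)"
proof -
  \<comment> \<open>\<open>Mu\<close> stops at the value 0 and needs successors before it, hence the
    program for the negation.\<close>
  obtain p where p: "\<And>f ys. f \<in> D \<Longrightarrow> length ys = Suc k \<Longrightarrow>
      computes f p ys (of_bool (\<not> P f (hd ys) (tl ys)))"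
    using decidable_on_not[OF assms(2)] unfolding computable_on_def by blast
  show ?thesis
  proof (rule computable_onI[where p = "Mu p"])
    fix f and xs :: "nat list"
    assume f: "f \<in> D" and len: "length xs = k"
    have p': "computes f p (n # xs) (of_bool (\<not> P f n xs))" for n
      using p[OF f, of "n # xs"] len by simp
    show "computes f (Mu p) xs (LEAST n. P f n xs)"
    proof (rule computes.mu)
      have "P f (LEAST n. P f n xs) xs" using assms(1)[OF f len] by (rule LeastI_ex)
      then show "computes f p ((LEAST n. P f n xs) # xs) 0"
        using p'[of "LEAST n. P f n xs"] by simp
      show "\<forall>m<LEAST n. P f n xs. \<exists>y. computes f p (m # xs) (Suc y)"
      proof (intro allI impI)
        fix m assume "m < (LEAST n. P f n xs)"
        then have "\<not> P f m xs" by (rule not_less_Least)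
        then show "\<exists>y. computes f p (m # xs) (Suc y)" using p'[of m] by auto
      qed
    qed
  qed
qed

lemmas computable_on_intros =
  computable_on_hd computable_on_Suc computable_on_query computable_on_add computable_on_mult
  computable_on_power computable_on_sum decidable_on_not decidable_on_conj decidable_on_disj
  decidable_on_imp decidable_on_iff decidable_on_le decidable_on_less decidable_on_eq
  decidable_on_ex_less decidable_on_all_less computable_on_const

lemma computable_on_prog_functional:
  assumes "computable_on D (Suc 0) (\<lambda>f xs. F f (hd xs))"
  obtains p where "\<And>f. f \<in> D \<Longrightarrow> prog_functional p f = Some (F f)"
proof -
  obtain p where "\<And>f xs. f \<in> D \<Longrightarrow> length xs = Suc 0 \<Longrightarrow> computes f p xs (F f (hd xs))"
    using assms by (auto simp: computable_on_def)
  then have "computes f p [n] (F f n)" if "f \<in> D" for f n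
    using that by (metis length_Cons list.sel(1) list.size(3))
  then show thesis
    by (intro that[of p]) (simp add: prog_functional_eq_Some_iff)
qed


section \<open>The order of a colouring\<close>

text \<open>The inner clause says that 1 is the more recent of 0 and 1. A 2 preceded by neither goes
  right.\<close>

definition left_side :: "(nat \<Rightarrow> nat) \<Rightarrow> nat \<Rightarrow> bool" where
  "left_side c n \<longleftrightarrow> c n = 0 \<or> c n = 2 \<and> (\<exists>p<n. c p = 1 \<and> (\<forall>q<n. p < q \<longrightarrow> c q \<noteq> 0))"

text \<open>Runs are taken within one side: positions on the side opposite to \<open>m\<close> do
  not interrupt them. The bound \<open>Suc n\<close> fits the rule for bounded quantifiers.\<close>

definition same_run :: "(nat \<Rightarrow> nat) \<Rightarrow> nat \<Rightarrow> nat \<Rightarrow> bool" where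
  "same_run c m n \<longleftrightarrow> (\<forall>p<Suc n. m \<le> p \<and> (left_side c p \<longleftrightarrow> left_side c m) \<longrightarrow> c p = c m)"

definition before :: "(nat \<Rightarrow> nat) \<Rightarrow> nat \<Rightarrow> nat \<Rightarrow> bool" where
  "before c m n \<longleftrightarrow>
     left_side c m \<and> \<not> left_side c n \<or>
     left_side c m \<and> left_side c n \<and> (m < n \<and> same_run c m n \<or> n < m \<and> \<not> same_run c n m) \<or>
     \<not> left_side c m \<and> \<not> left_side c n \<and> (m < n \<and> \<not> same_run c m n \<or> n < m \<and> same_run c n m)"

lemma same_runD:
  "same_run c m n \<Longrightarrow> m \<le> p \<Longrightarrow> p \<le> n \<Longrightarrow> left_side c p = left_side c m \<Longrightarrow> c p = c m"
  unfolding same_run_def by (metis le_imp_less_Suc)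

lemma same_runI:
  assumes "\<And>p. m \<le> p \<Longrightarrow> p \<le> n \<Longrightarrow> left_side c p = left_side c m \<Longrightarrow> c p = c m"
  shows "same_run c m n"
  unfolding same_run_def using assms by (metis less_Suc_eq_le)

text \<open>Since \<open>m\<close> is on the side of \<open>k\<close>, it carries the colour of a
  run through it, which glues or cuts runs at \<open>m\<close>. Transitivity of
  \<open>before\<close> rests on this.\<close>

lemma same_run_split:
  assumes le: "k \<le> m" "m \<le> n" and side: "left_side c k = left_side c m"
  shows "same_run c k n \<longleftrightarrow> same_run c k m \<and> same_run c m n"
proof
  assume kn: "same_run c k n"
  have m: "c m = c k" using same_runD[OF kn le] side by simp
  have "same_run c k m"
    by (rule same_runI) (rule same_runD[OF kn], use le in auto)
  moreover have "same_run c m n"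
  proof (rule same_runI)
    fix p assume "m \<le> p" "p \<le> n" "left_side c p = left_side c m"
    then show "c p = c m" using same_runD[OF kn, of p] le side m by simp
  qed
  ultimately show "same_run c k m \<and> same_run c m n" ..
next
  assume *: "same_run c k m \<and> same_run c m n"
  then have m: "c m = c k" using same_runD[of c k m m] le side by simp
  show "same_run c k n"
  proof (rule same_runI)
    fix p assume p: "k \<le> p" "p \<le> n" "left_side c p = left_side c k"
    show "c p = c k"
    proof (cases "p \<le> m")
      case True
      then show ?thesis using same_runD[of c k m p] * p by simp
    next
      case False
      then show ?thesis using same_runD[of c m n p] * p m side by simp
    qed
  qed
qed

section \<open>The axioms of a strict linear order\<close>

lemma before_irrefl: "\<not> before c n n"
  by (auto simp: before_def)

lemma before_total: "m \<noteq> n \<Longrightarrow> before c m n \<or> before c n m"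
  by (auto simp: before_def)

lemma before_trans:
  assumes "before c k m" and "before c m n"
  shows "before c k n"
proof (cases "left_side c k = left_side c m \<and> left_side c m = left_side c n")
  case False
  then show ?thesis using assms by (auto simp: before_def)
next
  case True
  \<comment> \<open>On a single side, the relation among three indices is thus fixed by the two
    numerically adjacent pairs.\<close>
  have split: "same_run c x z \<longleftrightarrow> same_run c x y \<and> same_run c y z"
    if "x < y" "y < z" "{x, y, z} = {k, m, n}" for x y z
    using that True by (intro same_run_split) auto
  \<comment> \<open>Irreflexivity rules out all coincidences but \<open>k = n\<close>, and that one
    contradicts asymmetry.\<close>
  consider "k < m" "m < n" | "k < n" "n < m" | "m < k" "k < n" | "m < n" "n < k"
    | "n < k" "k < m" | "n < m" "m < k" | "k = n" "m \<noteq> k"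
    using assms before_irrefl[of c] by (metis linorder_neqE_nat)
  then show ?thesis
  proof cases
    case 1 then show ?thesis using assms True split[of k m n] by (auto simp: before_def)
  next
    case 2 then show ?thesis using assms True split[of k n m] by (auto simp: before_def)
  next
    case 3 then show ?thesis using assms True split[of m k n] by (auto simp: before_def)
  next
    case 4 then show ?thesis using assms True split[of m n k] by (auto simp: before_def)
  next
    case 5 then show ?thesis using assms True split[of n k m] by (auto simp: before_def)
  next
    case 6 then show ?thesis using assms True split[of n m k] by (auto simp: before_def)
  next
    case 7
    have False
      using assms 7 unfolding 7(1) before_def by (cases "left_side c n"; cases "m < n") simp_all
    then show ?thesis ..
  qed
qed

text \<open>If 2 dies out, the sides hold 0 and 1. If 0 dies out and 1 occurs afterwards, all later
  2s go left and the 1s right; symmetrically if 1 dies out. If only 2 survives, the sides do not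
  matter.\<close>

lemma sides_eventually_monochromatic:
  assumes c: "\<And>n. c n < 3" and fin: "finite {n. c n = i}" and i: "i < 3"
  obtains N where "\<And>n. N \<le> n \<Longrightarrow> c n \<noteq> i"
    and "\<And>m n. N \<le> m \<Longrightarrow> N \<le> n \<Longrightarrow> left_side c m = left_side c n \<Longrightarrow> c m = c n"
proof -
  note result = that
  obtain N0 where N0: "\<And>n. N0 \<le> n \<Longrightarrow> c n \<noteq> i"
    using fin unfolding finite_nat_set_iff_bounded by (auto simp flip: not_le)
  have c': "c n = 0 \<or> c n = 1 \<or> c n = 2" for n using c[of n] by linarith
  \<comment> \<open>\<open>a\<close> and \<open>b\<close> are the eventual colours of the left and
    right side; a side may also be empty from \<open>N\<close> on.\<close>
  have mono: thesis if "N0 \<le> N"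
    and sides: "\<And>n. N \<le> n \<Longrightarrow> left_side c n \<Longrightarrow> c n = a"
      "\<And>n. N \<le> n \<Longrightarrow> \<not> left_side c n \<Longrightarrow> c n = b"
    for N a b
  proof (rule result[of N])
    show "c n \<noteq> i" if "N \<le> n" for n using N0 \<open>N0 \<le> N\<close> that by simp
    show "c m = c n" if "N \<le> m" "N \<le> n" "left_side c m = left_side c n" for m n
      using that sides by (cases "left_side c m") auto
  qed
  consider "i = 0" | "i = 1" | "i = 2" using i by linarith
  then show thesis
  proof cases
    case 1
    show ?thesis
    proof (cases "\<exists>m\<ge>N0. c m = 1")
      case True
      then obtain m where m: "N0 \<le> m" "c m = 1" by blast
      have "left_side c n" if "Suc m \<le> n" "c n = 2" for n
      proof -
        have "c q \<noteq> 0" if "m < q" for q using N0[of q] 1 m(1) that by simp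
        then show ?thesis using that m(2) by (auto simp: left_side_def Suc_le_eq)
      qed
      moreover have "c n \<noteq> 0" if "Suc m \<le> n" for n using that m(1) N0[of n] 1 by simp
      ultimately show ?thesis
        using m(1) c' by (intro mono[of "Suc m" 2 1]) (simp, metis left_side_def zero_neq_one, metis)
    next
      case False
      then show ?thesis using N0 1 c' by (intro mono[of N0 2 2]) blast+
    qed
  next
    case 2
    show ?thesis
    proof (cases "\<exists>m\<ge>N0. c m = 0")
      case True
      then obtain m where m: "N0 \<le> m" "c m = 0" by blast
      \<comment> \<open>Every 1 occurs before \<open>N0\<close>, so the 0 at \<open>m\<close> comes
        between it and \<open>n\<close>.\<close>
      have "\<not> left_side c n" if n: "Suc m \<le> n" "c n = 2" for n
      proof
        assume "left_side c n"
        then obtain p where p: "p < n" "c p = 1" "\<forall>q<n. p < q \<longrightarrow> c q \<noteq> 0"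
          using n(2) unfolding left_side_def by auto
        then have "p < m" using N0[of p] 2 m(1) by (metis le_trans not_le)
        moreover have "m < n" using n(1) by simp
        ultimately show False using p(3) m(2) by blast
      qed
      moreover have 1: "c n \<noteq> 1" if "Suc m \<le> n" for n using that m(1) N0[of n] 2 by simp
      moreover have "left_side c n" if "c n = 0" for n using that by (simp add: left_side_def)
      ultimately show ?thesis
        using m(1) c' 1 by (intro mono[of "Suc m" 0 2]) (simp, metis, metis)
    next
      case False
      then show ?thesis using N0 2 c' by (intro mono[of N0 2 2]) blast+
    qed
  next
    case 3
    have "left_side c n \<longleftrightarrow> c n = 0" if "N0 \<le> n" for n
      using N0[OF that] 3 by (auto simp: left_side_def)
    then show ?thesis
      using N0 c' 3 by (intro mono[of N0 0 1]) blast+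
  qed
qed

text \<open>Otherwise \<open>T\<close> has infinitely many late elements on one side. On the left
  they all lie below \<open>t\<close>, so \<open>T\<close> is not ascending; they form one ascending
  run, so infinitely many lie above any \<open>y\<close> among them and \<open>T\<close> is not
  descending. The right side is dual.\<close>

lemma chain_colour_infinite:
  assumes c: "\<And>n. c n < 3" and inf: "infinite T" and t: "t \<in> T"
    and chain: "(\<forall>y\<in>T. finite {x \<in> T. before c x y}) \<or> (\<forall>y\<in>T. finite {x \<in> T. before c y x})"
  shows "infinite {n. c n = c t}"
proof
  assume "finite {n. c n = c t}"
  then obtain N where N: "\<And>n. N \<le> n \<Longrightarrow> c n \<noteq> c t"
    and mono: "\<And>m n. N \<le> m \<Longrightarrow> N \<le> n \<Longrightarrow> left_side c m = left_side c n \<Longrightarrow> c m = c n"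
    using sides_eventually_monochromatic[of c "c t", OF c _ c] by metis
  \<comment> \<open>Beyond \<open>N\<close> each side is a single run; beyond \<open>t\<close> the
    elements are numerically larger than \<open>t\<close>, as \<open>off\<close> requires.\<close>
  define A where "A b = {n \<in> T. N + Suc t \<le> n \<and> left_side c n = b}" for b
  have run: "same_run c m n" if "N \<le> m" for m n
    by (rule same_runI) (use mono that le_trans in blast)
  have off: "\<not> same_run c t n" if "N + Suc t \<le> n" "left_side c n = left_side c t" for n
    using N[of n] same_runD[of c t n n] that by auto
  have "T \<subseteq> A True \<union> A False \<union> {..<N + Suc t}" by (auto simp: A_def)
  then have "infinite (A True) \<or> infinite (A False)"
    using inf by (meson finite_UnI finite_lessThan finite_subset)
  then obtain b where A: "infinite (A b)" by blast
  then obtain y where y: "y \<in> A b" by (metis finite.emptyI ex_in_conv)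
  have "A b = {x \<in> A b. x \<le> y} \<union> {x \<in> A b. y < x}" by auto
  then have A': "infinite {x \<in> A b. y < x}"
    using A by (metis (no_types, lifting) finite_Un finite_nat_set_iff_bounded_le mem_Collect_eq)
  have "y \<in> T" using y by (simp add: A_def)
  show False
  proof (cases b)
    case True
    have "A b \<subseteq> {x \<in> T. before c x t}"
      using off True by (auto simp: A_def before_def)
    moreover have "{x \<in> A b. y < x} \<subseteq> {x \<in> T. before c y x}"
      using run y True by (auto simp: A_def before_def)
    ultimately show False
      using chain A A' t \<open>y \<in> T\<close> by (meson finite_subset)
  next
    case False
    have "A b \<subseteq> {x \<in> T. before c t x}"
      using off False by (auto simp: A_def before_def)
    moreover have "{x \<in> A b. y < x} \<subseteq> {x \<in> T. before c x y}"
      using run y False by (auto simp: A_def before_def)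
    ultimately show False
      using chain A A' t \<open>y \<in> T\<close> by (meson finite_subset)
  qed
qed


section \<open>Coding initial segments of a colouring\<close>

definition prefix_code :: "(nat \<Rightarrow> nat) \<Rightarrow> nat \<Rightarrow> nat" where
  "prefix_code c n = (\<Sum>p<n. Suc (c p) * 4 ^ p)"

text \<open>The lowest base-4 digit of a point is the colour of the point itself; digit \<open>Suc p\<close> is
  \<open>Suc (c p)\<close>, hence nonzero exactly for the \<open>p\<close> covered by the coded prefix.\<close>

definition point :: "(nat \<Rightarrow> nat) \<Rightarrow> nat \<Rightarrow> nat" where
  "point c n = 4 * prefix_code c (Suc n) + c n"

text \<open>Digit \<open>d\<close> of \<open>z\<close> at position \<open>q\<close> in base 4,
  written with bounded witnesses for the higher and lower parts instead of division, so that
  decidability follows from the closure rules.\<close>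

definition has_digit :: "nat \<Rightarrow> nat \<Rightarrow> nat \<Rightarrow> bool" where
  "has_digit z q d \<longleftrightarrow> (\<exists>a<Suc z. \<exists>b<4 ^ q. z = (4 * a + d) * 4 ^ q + b)"

lemma has_digit_iff:
  assumes "d < 4"
  shows "has_digit z q d \<longleftrightarrow> z div 4 ^ q mod 4 = d"
proof
  assume "has_digit z q d"
  then obtain a b where "b < 4 ^ q" "z = (4 * a + d) * 4 ^ q + b" by (auto simp: has_digit_def)
  then have "z div 4 ^ q = 4 * a + d" by simp
  then show "z div 4 ^ q mod 4 = d" using assms by simp
next
  assume d: "z div 4 ^ q mod 4 = d"
  let ?a = "z div 4 ^ q div 4" and ?b = "z mod 4 ^ q"
  have "4 * ?a + d = z div 4 ^ q" using d by (metis mult_div_mod_eq)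
  then have "z = (4 * ?a + d) * 4 ^ q + ?b" by (simp only: div_mult_mod_eq)
  moreover have "?a < Suc z" by (meson div_le_dividend le_imp_less_Suc le_trans)
  moreover have "?b < 4 ^ q" by simp
  ultimately show "has_digit z q d" unfolding has_digit_def by blast
qed

lemma prefix_code_Suc_shift:
  "prefix_code c (Suc n) = Suc (c 0) + 4 * prefix_code (\<lambda>p. c (Suc p)) n"
  unfolding prefix_code_def sum.lessThan_Suc_shift
  by (simp add: sum_distrib_left algebra_simps)

text \<open>Induction on the position: dropping the lowest digit shifts the colouring, hence the
  generalization over \<open>c\<close>.\<close>

lemma prefix_code_digit:
  assumes "\<And>n. c n < 3"
  shows "prefix_code c n div 4 ^ p mod 4 = (if p < n then Suc (c p) else 0)"
  using assms
proof (induction p arbitrary: c n)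
  case 0
  show ?case
    using "0.prems"[of 0] by (cases n) (simp_all add: prefix_code_Suc_shift, simp add: prefix_code_def)
next
  case (Suc p)
  show ?case
  proof (cases n)
    case 0
    then show ?thesis by (simp add: prefix_code_def)
  next
    case (Suc n')
    have "prefix_code c n div 4 = prefix_code (\<lambda>p. c (Suc p)) n'"
      using Suc.prems[of 0] by (simp add: Suc prefix_code_Suc_shift)
    then have "prefix_code c n div 4 ^ Suc p = prefix_code (\<lambda>p. c (Suc p)) n' div 4 ^ p"
      by (simp add: div_mult2_eq)
    then show ?thesis using Suc.IH[of "\<lambda>p. c (Suc p)" n'] Suc.prems Suc by simp
  qed
qed

lemma point_mod:
  assumes "\<And>n. c n < 3"
  shows "point c n mod 4 = c n"
  using assms[of n] by (simp add: point_def)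

text \<open>Division by 4 strips the point's own colour, whence the shift to \<open>Suc p\<close>.
  Past the prefix the digit is 0, which is never \<open>Suc d\<close>.\<close>

lemma has_digit_point:
  assumes c: "\<And>n. c n < 3" and "d < 3"
  shows "has_digit (point c n) (Suc p) (Suc d) \<longleftrightarrow> p \<le> n \<and> d = c p"
proof -
  have "point c n div 4 = prefix_code c (Suc n)"
    using c[of n] by (simp add: point_def)
  then have "point c n div 4 ^ Suc p = prefix_code c (Suc n) div 4 ^ p"
    by (simp add: div_mult2_eq)
  then show ?thesis
    using assms(2) prefix_code_digit[of c "Suc n" p, OF c] by (subst has_digit_iff) auto
qed

text \<open>The added digit is nonzero, so the prefix code grows; four times that growth outweighs
  any drop in the lowest digit.\<close>

lemma strict_mono_point:
  assumes c: "\<And>n. c n < 3"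
  shows "strict_mono (point c)"
proof (unfold strict_mono_Suc_iff, rule allI)
  fix n
  have "0 < Suc (c (Suc n)) * 4 ^ Suc n" by simp
  then have "prefix_code c (Suc n) < prefix_code c (Suc (Suc n))"
    unfolding prefix_code_def by (subst (2) sum.lessThan_Suc) linarith
  then show "point c n < point c (Suc n)"
    using c[of n] by (simp add: point_def)
qed

definition order_field :: "(nat \<Rightarrow> nat) \<Rightarrow> nat set" where
  "order_field c = range (point c)"

definition order_rel :: "(nat \<Rightarrow> nat) \<Rightarrow> nat rel" where
  "order_rel c = {(point c a, point c b) | a b. before c a b}"

lemma is_lin_order_order_rel:
  assumes "\<And>n. c n < 3"
  shows "is_lin_order (order_field c) (order_rel c)"
proof -
  have inj: "point c a = point c b \<longleftrightarrow> a = b" for a b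
    using strict_mono_eq[OF strict_mono_point, of c] assms by blast
  show ?thesis
    unfolding is_lin_order_def strict_linear_order_on_def
  proof (intro conjI)
    show "order_rel c \<subseteq> order_field c \<times> order_field c"
      by (auto simp: order_rel_def order_field_def)
    show "trans (order_rel c)"
      by (rule transI) (auto simp: order_rel_def inj intro: before_trans)
    show "irrefl (order_rel c)"
      by (auto simp: irrefl_def order_rel_def inj before_irrefl)
    show "total_on (order_field c) (order_rel c)"
      using before_total[of _ _ c] by (auto simp: total_on_def order_field_def order_rel_def inj)
  qed
qed


section \<open>The two functionals\<close>

text \<open>The last equation says \<open>m = prod_encode (point c a, point c b)\<close> without division, by
  doubling the triangular number in the Cantor pairing.\<close>

definition order_functional :: "(nat \<Rightarrow> nat) \<Rightarrow> nat \<Rightarrow> nat" where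
  "order_functional c n = of_bool (\<exists>m<Suc n.
     n = 2 * m \<and> (\<exists>a<Suc m. m = point c a) \<or>
     n = Suc (2 * m) \<and> (\<exists>a<Suc m. \<exists>b<Suc m. before c a b \<and>
       2 * m = (point c a + point c b) * Suc (point c a + point c b) + 2 * point c a))"

text \<open>Unfolding leaves only bounded quantifiers and sums, so no search is involved and
  \<open>D\<close> is arbitrary.\<close>

lemma computable_on_order_functional:
  "computable_on D (Suc 0) (\<lambda>f xs. order_functional f (hd xs))"
  unfolding order_functional_def before_def same_run_def left_side_def point_def prefix_code_def
  by (intro computable_on_intros)

lemma prod_encode_eq_iff_double:
  "m = prod_encode (a, b) \<longleftrightarrow> 2 * m = (a + b) * Suc (a + b) + 2 * a"
proof -
  have "2 * triangle (a + b) = (a + b) * Suc (a + b)" by (simp add: triangle_def)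
  then show ?thesis unfolding prod_encode_def by auto
qed

lemma order_functional_eq:
  assumes c: "\<And>n. c n < 3"
  shows "order_functional c = order_code (order_field c) (order_rel c)"
proof
  fix n
  \<comment> \<open>An index is bounded by its point, and a point by any pair code containing it, so
    the bounds \<open>Suc m\<close> lose no witness.\<close>
  have le: "a \<le> point c a" for a
    using strict_mono_imp_increasing[OF strict_mono_point[of c]] c by blast
  have L: "(\<exists>a<Suc m. m = point c a) \<longleftrightarrow> m \<in> order_field c" for m
    using le by (auto simp: order_field_def less_Suc_eq_le)
  have R: "(\<exists>a<Suc m. \<exists>b<Suc m. before c a b \<and> m = prod_encode (point c a, point c b)) \<longleftrightarrow>
      m \<in> prod_encode ` order_rel c" for m
  proof -
    have "a < Suc m \<and> b < Suc m" if "m = prod_encode (point c a, point c b)" for a b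
      using that le[of a] le[of b] le_prod_encode_1 le_prod_encode_2
      by (metis le_imp_less_Suc le_trans)
    then show ?thesis by (auto simp: order_rel_def image_iff)
  qed
  have "n = 2 * m \<longleftrightarrow> even n \<and> m = n div 2" "n = Suc (2 * m) \<longleftrightarrow> odd n \<and> m = n div 2" for m
    by presburger+
  moreover have "n div 2 < Suc n" by simp
  ultimately have "(\<exists>m<Suc n. n = 2 * m \<and> m \<in> order_field c \<or>
      n = Suc (2 * m) \<and> m \<in> prod_encode ` order_rel c) \<longleftrightarrow>
    (if even n then n div 2 \<in> order_field c else n div 2 \<in> prod_encode ` order_rel c)"
    by metis
  then show "order_functional c n = order_code (order_field c) (order_rel c) n"
    unfolding order_functional_def prod_encode_eq_iff_double[symmetric] L R order_code_def char_fun_def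
    by simp
qed

text \<open>The first \<open>LEAST\<close> finds a chain element whose prefix reaches
  \<open>p\<close>. The others read the colour of the numerically least element as its remainder
  modulo 4.\<close>

definition colour_functional :: "(nat \<Rightarrow> nat) \<Rightarrow> nat \<Rightarrow> nat" where
  "colour_functional g p = of_bool (has_digit
     (LEAST z. g z = 1 \<and> (\<exists>d<3. has_digit z (Suc p) (Suc d))) (Suc p)
     (Suc (LEAST i. \<exists>a<Suc (LEAST z. g z = 1). (LEAST z. g z = 1) = 4 * a + i)))"

text \<open>On these oracles the searches of \<open>colour_functional\<close> halt. The colouring is
  existentially bound: the functional sees the set only.\<close>

definition chain_codes :: "(nat \<Rightarrow> nat) set" where
  "chain_codes = {char_fun S | S c. (\<forall>n. c n < 3) \<and> infinite S \<and> S \<subseteq> order_field c}"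

lemma Least_remainder: "(LEAST i. \<exists>a<Suc x. x = 4 * a + i) = x mod (4 :: nat)"
proof (rule Least_equality)
  have "x = 4 * (x div 4) + x mod 4" by simp
  moreover have "x div 4 < Suc x" by (simp add: less_Suc_eq_le)
  ultimately show "\<exists>a<Suc x. x = 4 * a + x mod 4" by blast
qed auto

lemma char_fun_eq_1: "char_fun S z = 1 \<longleftrightarrow> z \<in> S"
  by (simp add: char_fun_def)

text \<open>An infinite set of points is not contained in the first \<open>p\<close> of them. This
  makes the search for a long prefix halt.\<close>

lemma ex_long_prefix:
  assumes c: "\<And>n. c n < 3" and "infinite S" and "S \<subseteq> order_field c"
  shows "\<exists>z \<in> S. \<exists>d<3. has_digit z (Suc p) (Suc d)"
proof -
  have "\<not> S \<subseteq> point c ` {..<p}" using assms(2) finite_surj by blast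
  then obtain n where "point c n \<in> S" "p \<le> n"
    using assms(3) by (fastforce simp: order_field_def)
  then show ?thesis using has_digit_point[of c "c p" n p] c by blast
qed

lemma computable_on_colour_functional:
  "computable_on chain_codes (Suc 0) (\<lambda>g xs. colour_functional g (hd xs))"
proof -
  have first: "\<exists>z. g z = 1" if g: "g \<in> chain_codes" for g
  proof -
    obtain S where "g = char_fun S" "infinite S" using g by (auto simp: chain_codes_def)
    then show ?thesis using infinite_imp_nonempty[of S] by (auto simp: char_fun_def)
  qed
  have long: "\<exists>z. g z = 1 \<and> (\<exists>d<3. has_digit z (Suc p) (Suc d))" if chain: "g \<in> chain_codes" for g p
  proof -
    obtain S c where g: "g = char_fun S"
      and S: "\<And>n. c n < 3" "infinite S" "S \<subseteq> order_field c"
      using chain by (auto simp: chain_codes_def)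
    show ?thesis using ex_long_prefix[of c S p, OF S] unfolding g char_fun_eq_1 by blast
  qed
  \<comment> \<open>Halting of the remainder search, with \<open>a = 0\<close> and
    \<open>i = x\<close>.\<close>
  have rem: "\<exists>i. \<exists>a<Suc x. x = 4 * a + i" for x :: nat by (rule exI[of _ x]) auto
  show ?thesis
    using long[unfolded has_digit_def] unfolding colour_functional_def has_digit_def
    by (intro computable_on_intros computable_on_Least rem first)
qed

text \<open>All points of \<open>S\<close> code prefixes of the same \<open>c\<close>, so whichever
  long one is found shows the true colour of \<open>p\<close>. The index \<open>t\<close> is that of
  the numerically least point.\<close>

lemma colour_functional_eq:
  assumes c: "\<And>n. c n < 3" and S: "infinite S" "S \<subseteq> order_field c"
  obtains t where "point c t \<in> S" and "colour_functional (char_fun S) = char_fun {p. c p = c t}"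
proof -
  have "\<exists>z. z \<in> S" using S(1) by (metis finite.emptyI ex_in_conv)
  then have "(LEAST z. z \<in> S) \<in> S" by (rule LeastI_ex)
  then obtain t where t: "(LEAST z. z \<in> S) = point c t" "point c t \<in> S"
    using S(2) by (auto simp: order_field_def)
  have "colour_functional (char_fun S) p = char_fun {p. c p = c t} p" for p
  proof -
    let ?z = "LEAST z. z \<in> S \<and> (\<exists>d<3. has_digit z (Suc p) (Suc d))"
    have z: "?z \<in> S" "\<exists>d<3. has_digit ?z (Suc p) (Suc d)"
      using LeastI_ex[of "\<lambda>z. z \<in> S \<and> (\<exists>d<3. has_digit z (Suc p) (Suc d))"]
        ex_long_prefix[of c S p, OF c S] by blast+
    then obtain n where n: "?z = point c n" using S(2) by (auto simp: order_field_def)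
    have "colour_functional (char_fun S) p = of_bool (has_digit ?z (Suc p) (Suc (c t)))"
      unfolding colour_functional_def char_fun_eq_1 Least_remainder t(1) point_mod[of c, OF c] ..
    also have "\<dots> = of_bool (c t = c p)"
      using z(2) has_digit_point[of c, OF c] c unfolding n by auto
    finally show ?thesis by (auto simp: char_fun_def)
  qed
  then show thesis using that t(2) by blast
qed

theorem theorem4p22:
  shows "RT1 3 \<le>\<^sub>s\<^sub>W ADC"
proof -
  obtain p where p: "\<And>f. prog_functional p f = Some (order_functional f)"
    using computable_on_prog_functional[OF computable_on_order_functional[of UNIV]] by auto
  obtain q where q: "\<And>g. g \<in> chain_codes \<Longrightarrow> prog_functional q g = Some (colour_functional g)"
    using computable_on_prog_functional[OF computable_on_colour_functional] by auto
  have "\<exists>h \<in> Domain ADC. prog_functional p c = Some h \<and>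
      (\<forall>g. (h, g) \<in> ADC \<longrightarrow> (\<exists>k. prog_functional q g = Some k \<and> (c, k) \<in> RT1 3))"
    if "c \<in> Domain (RT1 3)" for c
  proof -
    let ?L = "order_field c" and ?r = "order_rel c"
    have c: "\<And>n. c n < 3" using that by (simp add: Domain_RT1)
    have inj: "inj (point c)" using strict_mono_point[of c] c strict_mono_imp_inj_on by blast
    have lin: "infinite ?L" "is_lin_order ?L ?r"
      using inj is_lin_order_order_rel c by (auto simp: order_field_def range_inj_infinite)
    have solve: "\<exists>k. prog_functional q g = Some k \<and> (c, k) \<in> RT1 3"
      if g: "(order_code ?L ?r, g) \<in> ADC" for g
    proof -
      obtain S where S: "g = char_fun S" "S \<subseteq> ?L" "infinite S"
        and chain: "ascending_chain ?r S \<or> descending_chain ?r S"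
        using g by (auto simp: ADC_def order_code_inject)
      obtain t where t: "point c t \<in> S"
        and eq: "colour_functional (char_fun S) = char_fun {p. c p = c t}"
        using colour_functional_eq[of c S, OF c S(3,2)] by blast
      \<comment> \<open>The chain is pulled back to indices; as \<open>point c\<close> is injective,
        finiteness of initial and final segments carries over.\<close>
      define T where "T = {n. point c n \<in> S}"
      have ST: "S = point c ` T" using S(2) by (auto simp: T_def order_field_def)
      have T: "infinite T" using S(3) unfolding ST by (blast dest: finite_imageI)
      have tT: "t \<in> T" using t by (simp add: T_def)
      have rel: "(point c a, point c b) \<in> ?r \<longleftrightarrow> before c a b" for a b
        using inj by (auto simp: order_rel_def inj_eq)
      have "{x \<in> S. (x, point c y) \<in> ?r} = point c ` {x \<in> T. before c x y}"
        and "{x \<in> S. (point c y, x) \<in> ?r} = point c ` {x \<in> T. before c y x}" for y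
        by (auto simp: ST rel)
      then have "(\<forall>y\<in>T. finite {x \<in> T. before c x y}) \<or> (\<forall>y\<in>T. finite {x \<in> T. before c y x})"
        using chain inj unfolding ascending_chain_def descending_chain_def ST
        by (simp add: finite_image_iff inj_on_subset)
      then have "infinite {p. c p = c t}"
        using chain_colour_infinite[of c T t, OF c T tT] by blast
      then have "(c, char_fun {p. c p = c t}) \<in> RT1 3"
        using c by (auto simp: RT1_def)
      moreover have "g \<in> chain_codes" using S c by (auto simp: chain_codes_def)
      ultimately show ?thesis using q[of g] eq S(1) by auto
    qed
    have "order_code ?L ?r \<in> Domain ADC" using lin by (auto simp: Domain_ADC)
    then show ?thesis using solve p[of c] order_functional_eq[of c, OF c] by auto
  qed
  then show ?thesis unfolding sW_reducible_def turing_functional_def by blast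
qed

end
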